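(* For every $d\in\mathbb N$ there are infinitely many $n\in\mathbb N$ such that \[ H_{\mathrm{s}}(n,d)\ \ge\ \frac{n^{d-1}}{(d+2)^{d-1}}-3 . \]
   Context: A pure simplicial complex of dimension $d-1$ (a $(d-1)$-complex) on a vertex set $V$ is a family $C$ of $d$-element subsets of $V$, called facets; it has $n$ vertices when $|V|=n$. A ridge is a $(d-1)$-element subset of a facet. The dual (adjacency) graph $G(C)$ has the facets of $C$ as vertices, with $X,Y$ adjacent iff $|X\cap Y|=d-1$ (they share a ridge). $C$ is strongly connected if $G(C)$ is connected, and the (combinatorial) diameter of $C$ is the graph diameter of $G(C)$. $H_{\mathrm{s}}(n,d)$ denotes the maximum diameter of a strongly connected pure $(d-1)$-complex with $n$ vertices. *)

theory Defs
  imports "Graph_Theory.Graph_Theory"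
begin

text \<open>The definitions are parametrised by \<open>d\<close>, the common size of the facets, so that the
  complexes have dimension \<open>d - 1\<close>. A vertex need not lie in any facet.\<close>

definition pure_complex :: "nat \<Rightarrow> 'a set \<Rightarrow> 'a set set \<Rightarrow> bool" where
  "pure_complex d V C \<longleftrightarrow> (\<forall>X\<in>C. X \<subseteq> V \<and> finite X \<and> card X = d)"

text \<open>Undirected graphs are symmetric digraphs. Adjacency of \<open>X\<close> and \<open>Y\<close> means
  \<open>card (X \<inter> Y) = d - 1\<close>; it is written without truncated subtraction so that it stays
  loop-free for \<open>d = 0\<close>.\<close>

definition dual_graph :: "nat \<Rightarrow> 'a set set \<Rightarrow> 'a set pair_pre_digraph" where
  "dual_graph d C = \<lparr> pverts = C, parcs = {(X, Y). X \<in> C \<and> Y \<in> C \<and> card (X \<inter> Y) + 1 = d} \<rparr>"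

text \<open>The library's connectedness requires at least one vertex, so a strongly connected complex
  is non-empty.\<close>

definition strongly_connected_complex :: "nat \<Rightarrow> 'a set set \<Rightarrow> bool" where
  "strongly_connected_complex d C \<longleftrightarrow> Digraph_Component.connected (with_proj (dual_graph d C))"

text \<open>With unit weights, the weighted distance of the library is the number of arcs on a
  shortest walk (\<open>\<infinity>\<close> if there is none).\<close>

definition graph_diameter :: "('a, 'b) pre_digraph \<Rightarrow> ereal" where
  "graph_diameter G = (SUP u\<in>verts G. SUP v\<in>verts G. wf_digraph.\<mu> G (\<lambda>_. 1) u v)"

definition complex_diameter :: "nat \<Rightarrow> 'a set set \<Rightarrow> ereal" where
  "complex_diameter d C = graph_diameter (with_proj (dual_graph d C))"

text \<open>Every finite vertex set can be relabelled by natural numbers, so the ground type \<open>nat\<close>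
  loses no generality. By \<open>diameters_finite\<close> and \<open>diameters_nonempty\<close> below, \<open>Max\<close> is a
  genuine maximum whenever \<open>d \<le> n\<close>; for \<open>n < d\<close> no strongly connected complex exists
  and \<open>H_s n d\<close> is unspecified.\<close>

definition diameters :: "nat \<Rightarrow> nat \<Rightarrow> ereal set" where
  "diameters n d = {complex_diameter d C | (V :: nat set) C.
     finite V \<and> card V = n \<and> pure_complex d V C \<and> strongly_connected_complex d C}"

definition H_s :: "nat \<Rightarrow> nat \<Rightarrow> ereal" where
  "H_s n d = Max (diameters n d)"

lemma dual_graph_simps [simp]:
  "pverts (dual_graph d C) = C"
  "parcs (dual_graph d C) = {(X, Y). X \<in> C \<and> Y \<in> C \<and> card (X \<inter> Y) + 1 = d}"
  by (simp_all add: dual_graph_def)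

lemma pure_complex_finite:
  assumes "pure_complex d V C" "finite V"
  shows "finite C" "card C \<le> 2 ^ card V"
proof -
  have sub: "C \<subseteq> Pow V" using assms by (auto simp: pure_complex_def)
  show "finite C" using sub assms(2) by (meson finite_Pow_iff finite_subset)
  show "card C \<le> 2 ^ card V"
    using sub assms(2) card_mono[of "Pow V" C] by (simp add: card_Pow)
qed

lemma dual_graph_pair_graph:
  assumes "pure_complex d V C" "finite V"
  shows "pair_graph (dual_graph d C)"
proof -
  have C: "finite C" using pure_complex_finite[OF assms] by simp
  have "finite (parcs (dual_graph d C))"
    by (rule finite_subset[of _ "C \<times> C"]) (use C in auto)
  moreover have "sym (parcs (dual_graph d C))"
    by (auto simp: sym_def Int_commute)
  ultimately show ?thesis
    using assms(1) C
    by unfold_locales (auto simp: symmetric_def pure_complex_def)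
qed

lemma strongly_connected_complex_iff:
  assumes "pure_complex d V C" "finite V"
  shows "strongly_connected_complex d C \<longleftrightarrow>
    C \<noteq> {} \<and> (\<forall>X\<in>C. \<forall>Y\<in>C. X \<rightarrow>\<^sup>*\<^bsub>with_proj (dual_graph d C)\<^esub> Y)"
proof -
  interpret pair_graph "dual_graph d C" by (rule dual_graph_pair_graph[OF assms])
  have "mk_symmetric (with_proj (dual_graph d C)) = dual_graph d C"
    by (auto simp: mk_symmetric_def dual_graph_def Int_commute)
  then show ?thesis
    by (simp add: strongly_connected_complex_def connected_def strongly_connected_def)
qed

lemma complex_diameter_nat:
  assumes "pure_complex d V C" "finite V" "strongly_connected_complex d C"
  obtains k where "complex_diameter d C = ereal (real k)" "k < card C"
proof -
  let ?G = "with_proj (dual_graph d C)"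
  interpret pair_graph "dual_graph d C" by (rule dual_graph_pair_graph[OF assms(1,2)])
  have ne: "C \<noteq> {}" and fin: "finite C"
    and reach: "\<And>X Y. X \<in> C \<Longrightarrow> Y \<in> C \<Longrightarrow> X \<rightarrow>\<^sup>*\<^bsub>?G\<^esub> Y"
    using strongly_connected_complex_iff[OF assms(1,2)] assms(3)
      pure_complex_finite[OF assms(1,2)] by auto
  define S where "S = (\<lambda>k. ereal (real k)) ` {..<card C}"
  have dist: "wf_digraph.\<mu> ?G (\<lambda>_. 1) X Y \<in> S" if XY: "X \<in> C" "Y \<in> C" for X Y
  proof -
    obtain p where p: "apath X p Y" "\<mu> (\<lambda>_. 1) X Y = awalk_cost (\<lambda>_. 1) p"
      using min_cost_awalk[OF reach[OF XY], of "\<lambda>_. 1"] by auto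
    have "length p < card C" using length_apath_less[OF p(1)] by simp
    moreover have "awalk_cost (\<lambda>_. 1) p = real (length p)"
      by (simp add: awalk_cost_def sum_list_triv)
    ultimately show ?thesis using p(2) by (auto simp: S_def)
  qed
  have finS: "finite S" by (simp add: S_def)
  have Sup_in: "Sup A \<in> S" if "A \<subseteq> S" "A \<noteq> {}" for A
    using that finite_subset[OF that(1) finS] Max_Sup[of A] Max_in[of A] by auto
  have "(SUP Y\<in>C. wf_digraph.\<mu> ?G (\<lambda>_. 1) X Y) \<in> S" if "X \<in> C" for X
    by (rule Sup_in) (use that dist ne in auto)
  then have "(SUP X\<in>C. SUP Y\<in>C. wf_digraph.\<mu> ?G (\<lambda>_. 1) X Y) \<in> S"
    by (intro Sup_in) (use ne in auto)
  then have "complex_diameter d C \<in> S"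
    by (simp add: complex_diameter_def graph_diameter_def)
  then show ?thesis using that by (auto simp: S_def)
qed

lemma diameters_finite: "finite (diameters n d)"
proof (rule finite_subset)
  show "diameters n d \<subseteq> (\<lambda>k. ereal (real k)) ` {..2 ^ n}"
  proof
    fix x assume "x \<in> diameters n d"
    then obtain V :: "nat set" and C where *: "finite V" "card V = n" "pure_complex d V C"
        "strongly_connected_complex d C" "x = complex_diameter d C"
      by (auto simp: diameters_def)
    obtain k where "complex_diameter d C = ereal (real k)" "k < card C"
      using complex_diameter_nat[OF *(3,1,4)] by blast
    then show "x \<in> (\<lambda>k. ereal (real k)) ` {..2 ^ n}"
      using pure_complex_finite(2)[OF *(3,1)] * by auto
  qed
qed simp

lemma diameters_nonempty:
  assumes "d \<le> n"
  shows "diameters n d \<noteq> {}"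
proof -
  let ?C = "{{..<d}}"
  have p: "pure_complex d {..<n} ?C" using assms by (auto simp: pure_complex_def)
  interpret pair_graph "dual_graph d ?C" by (rule dual_graph_pair_graph[OF p]) simp
  have "strongly_connected_complex d ?C"
    using strongly_connected_complex_iff[OF p] by (auto intro: reachable_refl)
  then show ?thesis using p by (fastforce simp: diameters_def)
qed

end

theory Submission
  imports Defs
    "HOL-Algebra.Multiplicative_Group"
    "HOL-Algebra.Algebraic_Closure_Type"
    "HOL-Number_Theory.Totient"
    "HOL-Library.Z2"
    "HOL-Real_Asymp.Real_Asymp"
begin

text \<open>
  Put \<open>m = d - 1\<close> and \<open>q = 2 ^ k\<close>, and take \<open>n = (m + 3) q\<close> vertices, namely \<open>q\<close> symbols in each
  of \<open>m + 3\<close> colours. A sequence \<open>s\<close> over the symbols gives the complex whose facets are the windows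
  of \<open>m + 1\<close> consecutive terms, the term at position \<open>t\<close> having colour \<open>t mod (m + 3)\<close>. The
  spare two colours force two windows that share a ridge to be aligned or shifted by one. Hence the
  dual graph is an induced path as soon as windows at different positions below \<open>q ^ m - 1\<close> never
  agree in all but one place.

  Such a sequence is \<open>s t = Tr (\<alpha> ^ t)\<close>, where \<open>Tr\<close> is the trace from the field with \<open>q ^ m\<close>
  elements to the field with \<open>q\<close> elements, \<open>\<alpha>\<close> is a primitive element, and any \<open>m\<close> of the powers
  \<open>1, \<alpha>, \<dots>, \<alpha> ^ m\<close> are linearly independent over the small field. At most
  \<open>(m + 1)\<^sup>2 m q ^ (m - 1)\<close> elements violate the independence, since they are roots of polynomials of
  degree at most \<open>m\<close> with a missing monomial. The number of primitive elements is
  the totient of \<open>q ^ m - 1\<close>, which is at least \<open>(q ^ m - 1) / (k m)\<close>; so \<open>\<alpha>\<close> exists for large \<open>k\<close>.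
\<close>

section \<open>A lower bound for the totient function\<close>

text \<open>The i-th smallest element of \<open>A\<close> is at least i + 1, so the product
  dominates the telescoping product of the factors i / (i + 1). Removing the maximum turns this into
  an induction.\<close>

lemma prod_one_minus_inverse_ge:
  assumes "finite A" "\<And>p. p \<in> A \<Longrightarrow> p \<ge> (2::nat)"
  shows "(\<Prod>p\<in>A. 1 - 1 / real p) \<ge> 1 / (real (card A) + 1)"
  using assms
proof (induction A rule: finite_linorder_max_induct)
  case (insert b A)
  have "A \<subseteq> {2..<b}" using insert by auto
  then have "card A \<le> b - 2" using card_mono[of "{2..<b}" A] by simp
  moreover have "b \<ge> 2" using insert.prems by simp
  ultimately have b: "real b \<ge> real (card A) + 2" by linarith
  have "1 / (real (card A) + 2) = (1 - 1 / (real (card A) + 2)) * (1 / (real (card A) + 1))"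
    by (simp add: field_simps)
  also have "\<dots> \<le> (1 - 1 / real b) * (\<Prod>p\<in>A. 1 - 1 / real p)"
    using b insert by (intro mult_mono diff_mono divide_left_mono) auto
  finally have "1 / (real (card A) + 2) \<le> (1 - 1 / real b) * (\<Prod>p\<in>A. 1 - 1 / real p)" .
  moreover have "b \<notin> A" using insert.hyps(2) by blast
  ultimately show ?case using insert.hyps(1) by (simp add: add.commute)
qed simp

text \<open>Each prime factor contributes at least 2 to \<open>N\<close>, so \<open>N\<close> has
  fewer than \<open>l\<close> of them; Euler's product formula and the preceding bound then give
  totient N / N \<ge> 1 / l.\<close>

lemma le_totient_mult_log:
  assumes "0 < N" "N < 2 ^ l"
  shows "N \<le> l * totient N"
proof -
  let ?w = "card (prime_factors N)"
  have "2 ^ ?w = (\<Prod>p\<in>prime_factors N. 2::nat)" by simp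
  also have "\<dots> \<le> (\<Prod>p\<in>prime_factors N. p ^ multiplicity p N)"
  proof (intro prod_mono conjI)
    fix p assume p: "p \<in> prime_factors N"
    then have "2 \<le> p" "0 < multiplicity p N"
      by (auto simp: prime_factors_multiplicity prime_ge_2_nat)
    then show "2 \<le> p ^ multiplicity p N" using self_le_power[of p "multiplicity p N"] by linarith
  qed simp
  also have "\<dots> = N" using prime_factorization_nat[of N] assms by simp
  finally have "(2::nat) ^ ?w < 2 ^ l" using assms by linarith
  then have w: "?w < l" by simp
  have "1 / real l \<le> 1 / (real ?w + 1)" using w by (intro divide_left_mono) auto
  also have "\<dots> \<le> (\<Prod>p\<in>prime_factors N. 1 - 1 / real p)"
    by (rule prod_one_minus_inverse_ge) (auto dest: in_prime_factors_imp_prime prime_ge_2_nat)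
  finally have "real N * (1 / real l) \<le> real (totient N)"
    unfolding totient_formula2[of N] by (intro mult_left_mono) auto
  then have "real N \<le> real (l * totient N)" using w by (simp add: field_simps)
  then show ?thesis by linarith
qed

section \<open>Finite fields inside an algebraically closed field\<close>

lemma card_poly_roots_le:
  fixes p :: "'a::idom poly"
  assumes "p \<noteq> 0"
  shows "finite {x. poly p x = 0}" "card {x. poly p x = 0} \<le> degree p"
proof -
  have "(\<Sum>x\<in>set_mset (proots p). 1) \<le> (\<Sum>x\<in>set_mset (proots p). count (proots p) x)"
    by (rule sum_mono) (metis Suc_leI count_greater_zero_iff One_nat_def)
  then have "card (set_mset (proots p)) \<le> size (proots p)"
    by (simp only: size_multiset_overloaded_eq card_eq_sum)
  then show "card {x. poly p x = 0} \<le> degree p"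
    using size_proots_le[of p] assms by simp
  show "finite {x. poly p x = 0}" using poly_roots_finite[OF assms] .
qed

text \<open>If \<open>Q\<close> is a power of the characteristic and the field is algebraically closed, this is its
  subfield with \<open>Q\<close> elements.\<close>

definition gf :: "nat \<Rightarrow> 'a::field set" where
  "gf Q = {x. x ^ Q = x}"

text \<open>On \<open>gf (q ^ m)\<close> this is the field trace down to \<open>gf q\<close>,
  written as the sum of the conjugates under the q-th power map.\<close>

definition trace_sum :: "nat \<Rightarrow> nat \<Rightarrow> 'a::field \<Rightarrow> 'a" where
  "trace_sum q m x = (\<Sum>i<m. x ^ (q ^ i))"

context
  fixes Q e :: nat and ty :: "'a::field itself"
  assumes char: "prime CHAR('a)" and Q: "Q = CHAR('a) ^ e"
begin

lemma power_diff_char: "(x - y :: 'a) ^ Q = x ^ Q - y ^ Q"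
  using freshmans_dream'[OF char Q, of "x - y" y] by (simp add: algebra_simps)

lemma gf_0: "(0::'a) \<in> gf Q" and gf_1: "(1::'a) \<in> gf Q"
  using prime_gt_0_nat[OF char] by (simp_all add: gf_def Q)

lemma gf_add: "x \<in> gf Q \<Longrightarrow> y \<in> gf Q \<Longrightarrow> (x + y :: 'a) \<in> gf Q"
  by (simp add: gf_def freshmans_dream'[OF char Q])

lemma gf_diff: "x \<in> gf Q \<Longrightarrow> y \<in> gf Q \<Longrightarrow> (x - y :: 'a) \<in> gf Q"
  by (simp add: gf_def power_diff_char)

lemma gf_mult: "x \<in> gf Q \<Longrightarrow> y \<in> gf Q \<Longrightarrow> (x * y :: 'a) \<in> gf Q"
  by (simp add: gf_def power_mult_distrib)

lemma gf_inverse: "x \<in> gf Q \<Longrightarrow> (inverse x :: 'a) \<in> gf Q"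
  by (simp add: gf_def power_inverse)

lemma gf_power: "x \<in> gf Q \<Longrightarrow> (x ^ n :: 'a) \<in> gf Q"
  by (induction n) (auto intro: gf_1 gf_mult)

lemma gf_sum: "(\<And>i. i \<in> I \<Longrightarrow> f i \<in> gf Q) \<Longrightarrow> (sum f I :: 'a) \<in> gf Q"
  by (induction I rule: infinite_finite_induct) (auto intro: gf_0 gf_add)

text \<open>Presenting the subset \<open>gf Q\<close> as a ring with a carrier makes the theorems on
  multiplicative groups of finite fields applicable to it.\<close>

definition gf_ring :: "'a ring" where
  "gf_ring = \<lparr>carrier = gf Q, monoid.mult = (*), one = 1, ring.zero = 0, add = (+)\<rparr>"

lemma gf_ring_simps:
  "carrier gf_ring = gf Q" "monoid.mult gf_ring = (*)" "one gf_ring = 1"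
  "ring.zero gf_ring = 0" "add gf_ring = (+)"
  by (simp_all add: gf_ring_def)

lemma field_gf_ring: "field gf_ring"
proof -
  have "\<exists>y\<in>gf Q. x + y = 0" if "x \<in> gf Q" for x :: 'a
    using gf_diff[OF gf_0 that] by (intro bexI[of _ "0 - x"]) auto
  moreover have "\<exists>y\<in>gf Q. x * y = 1" if "x \<in> gf Q" "x \<noteq> 0" for x :: 'a
    using gf_inverse[OF that(1)] that(2) by (intro bexI[of _ "inverse x"]) auto
  ultimately show ?thesis
    by unfold_locales
      (auto simp: gf_ring_simps Units_def algebra_simps gf_0 gf_1 gf_add gf_mult add_eq_0_iff)
qed

end

lemma gf_subset_gf_power: "gf q \<subseteq> gf (q ^ m)"
proof
  fix x :: 'a assume x: "x \<in> gf q"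
  have "x ^ (q ^ m) = x"
    by (induction m) (use x in \<open>simp_all add: gf_def power_mult\<close>)
  then show "x \<in> gf (q ^ m)" by (simp add: gf_def)
qed

text \<open>The polynomial X^Q - X splits into linear factors, and its derivative is the constant -1
  because Q vanishes in the field. A repeated root would be a root of the derivative, so there are Q
  distinct roots.\<close>

lemma card_gf:
  fixes Q :: nat
  assumes char: "prime CHAR('a::alg_closed_field)" and Q: "Q = CHAR('a) ^ e" and e: "e > 0"
  shows "card (gf Q :: 'a set) = Q" "finite (gf Q :: 'a set)"
proof -
  define p :: "'a poly" where "p = monom 1 Q - monom 1 1"
  have "Q > 1" using prime_gt_1_nat[OF char] e unfolding Q by (rule one_less_power)
  have deg: "degree p = Q"
    unfolding p_def diff_conv_add_uminus using \<open>Q > 1\<close>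
    by (subst degree_add_eq_left) (auto simp: degree_monom_eq)
  have "coeff p Q = 1" using \<open>Q > 1\<close> by (simp add: p_def)
  then have lead: "lead_coeff p = 1" "p \<noteq> 0" using deg by auto
  have "of_nat Q = (0 :: 'a)" unfolding of_nat_eq_0_iff_char_dvd Q using e by simp
  then have deriv: "pderiv p = [:-1:]"
    by (simp add: p_def pderiv_diff pderiv_monom monom_0)
  obtain A where A: "size A = Q" "p = (\<Prod>x\<in>#A. [:-x, 1:])"
    using alg_closed_imp_factorization[OF lead(2)] lead deg by auto
  have count: "count A x = 1" if x: "x \<in># A" for x
  proof (rule ccontr)
    assume "count A x \<noteq> 1"
    obtain A' where A': "A = add_mset x A'" using multi_member_split[OF x] by blast
    with \<open>count A x \<noteq> 1\<close> have xA': "x \<in># A'" by (simp add: not_in_iff)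
    obtain B where "A' = add_mset x B" using multi_member_split[OF xA'] by blast
    with A' have B: "A = add_mset x (add_mset x B)" by simp
    have "p = [:-x, 1:] * ([:-x, 1:] * (\<Prod>x\<in>#B. [:-x, 1:]))"
      unfolding A(2) B by (simp only: image_mset_add_mset prod_mset.add_mset)
    moreover have "poly [:-x, 1:] x = 0" by simp
    ultimately have "poly (pderiv p) x = 0"
      by (simp only: pderiv_mult poly_add poly_mult mult_zero_left mult_zero_right add_0_right)
    then show False by (simp add: deriv)
  qed
  have "set_mset A = gf Q"
  proof -
    have "x \<in># A \<longleftrightarrow> poly p x = 0" for x
      by (auto simp: A(2) poly_prod_mset prod_mset_zero_iff)
    then show ?thesis by (auto simp: p_def gf_def poly_monom)
  qed
  moreover have "card (set_mset A) = size A"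
    by (simp add: size_multiset_overloaded_eq count)
  ultimately show "card (gf Q :: 'a set) = Q" using A(1) by simp
  then show "finite (gf Q :: 'a set)" using \<open>Q > 1\<close> by (intro card_ge_0_finite) simp
qed

text \<open>The multiplicative group is cyclic of order \<open>Q - 1\<close>, hence has
  \<open>totient (Q - 1)\<close> elements of full order, and the powers of such an element with
  exponents below the order are distinct.\<close>

lemma totient_le_card_primitive:
  fixes Q :: nat
  assumes char: "prime CHAR('a::alg_closed_field)" and Q: "Q = CHAR('a) ^ e" and e: "e > 0"
  shows "totient (Q - 1) \<le> card {x :: 'a \<in> gf Q. inj_on (\<lambda>i::nat. x ^ i) {..<Q - 1}}"
proof -
  define R :: "'a ring" where "R = gf_ring Q"
  note R = gf_ring_simps[OF char Q, folded R_def]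
  interpret field R unfolding R_def by (rule field_gf_ring[OF char Q])
  interpret G: group "Multiplicative_Group.mult_of R" by (rule field_mult_group)
  have fin: "finite (carrier R)" using card_gf[OF char Q e] by (simp add: R)
  then have finG: "finite (carrier (Multiplicative_Group.mult_of R))" by simp
  have order: "Coset.order (Multiplicative_Group.mult_of R) = Q - 1"
    using order_mult_of[OF fin] card_gf(1)[OF char Q e] by (simp add: Coset.order_def R)
  have pow: "x [^]\<^bsub>Multiplicative_Group.mult_of R\<^esub> (n::nat) = x ^ n" for x n
    by (induction n) (simp_all add: R nat_pow_def mult.commute)
  obtain a where a: "a \<in> carrier (Multiplicative_Group.mult_of R)" "carrier (Multiplicative_Group.mult_of R) = {a [^]\<^bsub>R\<^esub> i | i::nat. i \<in> UNIV}"
    using finite_field_mult_group_has_gen[OF fin] by blast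
  \<comment> \<open>The count of elements of order \<open>Q - 1\<close> requires one such element.
    The generator \<open>a\<close> is one: its powers with exponents up to \<open>ord a - 1\<close>
    already exhaust the group.\<close>
  have "carrier (Multiplicative_Group.mult_of R) =
      {a [^]\<^bsub>Multiplicative_Group.mult_of R\<^esub> i | i::nat. i \<in> UNIV}"
    using a(2) by (simp only: Multiplicative_Group.nat_pow_mult_of)
  also have "\<dots> = {a [^]\<^bsub>Multiplicative_Group.mult_of R\<^esub> i | i. i \<in> {0..G.ord a - 1}}"
    by (rule G.ord_elems[OF finG a(1)])
  also have "\<dots> = (\<lambda>i. a [^]\<^bsub>Multiplicative_Group.mult_of R\<^esub> i) ` {0..G.ord a - 1}"
    by blast
  finally have "Coset.order (Multiplicative_Group.mult_of R) \<le> card {0..G.ord a - 1}"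
    unfolding Coset.order_def using card_image_le[of "{0..G.ord a - 1}"] by simp
  also have "\<dots> = G.ord a" using G.ord_ge_1[OF finG a(1)] by simp
  finally have "G.ord a = Coset.order (Multiplicative_Group.mult_of R)"
    using G.ord_le_group_order[OF finG a(1)] by simp
  then have "card {x \<in> carrier (Multiplicative_Group.mult_of R). G.ord x = Q - 1} = phi' (Q - 1)"
    using num_elems_of_ord_eq_phi'[OF fin, of "Q - 1"] a(1) order by auto
  also have "phi' (Q - 1) = totient (Q - 1)"
    by (auto simp: phi'_def totient_def totatives_def intro!: arg_cong[of _ _ card])
  finally have "totient (Q - 1) = card {x \<in> carrier (Multiplicative_Group.mult_of R). G.ord x = Q - 1}" ..
  also have "\<dots> \<le> card {x :: 'a \<in> gf Q. inj_on (\<lambda>i::nat. x ^ i) {..<Q - 1}}"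
  proof (rule card_mono)
    show "finite {x :: 'a \<in> gf Q. inj_on (\<lambda>i::nat. x ^ i) {..<Q - 1}}"
      using card_gf(2)[OF char Q e] by simp
    have "inj_on (\<lambda>i::nat. x ^ i) {..<Q - 1}" if "x \<in> carrier (Multiplicative_Group.mult_of R)" "G.ord x = Q - 1" for x
    proof -
      have "{..<Q - 1} \<subseteq> {0..G.ord x - 1}" using that(2) by auto
      from inj_on_subset[OF G.ord_inj[OF that(1)] this] show ?thesis by (simp add: pow)
    qed
    then show "{x \<in> carrier (Multiplicative_Group.mult_of R). G.ord x = Q - 1} \<subseteq> {x \<in> gf Q. inj_on (\<lambda>i::nat. x ^ i) {..<Q - 1}}"
      by (auto simp: R)
  qed
  finally show ?thesis .
qed

section \<open>Trace sequences\<close>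

text \<open>An element avoids this set exactly when any \<open>m\<close> of its powers with
  exponents 0 to \<open>m\<close> are linearly independent over \<open>gf q\<close>; the zero
  coefficient stands for the omitted power.\<close>

definition sparse_roots :: "nat \<Rightarrow> nat \<Rightarrow> 'a::field set" where
  "sparse_roots q m = {x. \<exists>c. (\<forall>k\<le>m. c k \<in> gf q) \<and> (\<exists>k\<le>m. c k = 0) \<and> (\<exists>k\<le>m. c k \<noteq> 0) \<and>
     (\<Sum>k\<le>m. c k * x ^ k) = 0}"

text \<open>A union bound: choose an index \<open>a\<close> with coefficient 0 and an index
  \<open>b\<close> whose coefficient is scaled to 1. The other \<open>m - 1\<close> coefficients are
  free, and each resulting nonzero polynomial has at most \<open>m\<close> roots.\<close>

lemma card_sparse_roots:
  fixes q :: nat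
  assumes char: "prime CHAR('a::alg_closed_field)" and q: "q = CHAR('a) ^ e" and e: "e > 0"
  shows "finite (sparse_roots q m :: 'a set)"
    and "card (sparse_roots q m :: 'a set) \<le> (m + 1) ^ 2 * (q ^ (m - 1) * m)"
proof -
  define I where "I = {(a, b). a \<le> m \<and> b \<le> m \<and> a \<noteq> b}"
  define D :: "nat \<times> nat \<Rightarrow> (nat \<Rightarrow> 'a) set" where
    "D = (\<lambda>(a, b). \<Pi>\<^sub>E k\<in>{..m}. if k = a then {0} else if k = b then {1} else gf q)"
  define Z :: "(nat \<Rightarrow> 'a) \<Rightarrow> 'a set" where "Z = (\<lambda>c. {x. (\<Sum>k\<le>m. c k * x ^ k) = 0})"
  have "I \<subseteq> {..m} \<times> {..m}" by (auto simp: I_def)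
  then have I: "finite I" "card I \<le> (m + 1) ^ 2"
    using finite_subset[of I "{..m} \<times> {..m}"] card_mono[of "{..m} \<times> {..m}" I]
    by (auto simp: power2_eq_square)
  have D: "card (D i) = q ^ (m - 1)" "finite (D i)" if "i \<in> I" for i
  proof -
    obtain a b where i: "i = (a, b)" and ab: "a \<le> m" "b \<le> m" "a \<noteq> b"
      using \<open>i \<in> I\<close> by (auto simp: I_def)
    show "finite (D i)" unfolding i D_def prod.case
      by (rule finite_PiE) (auto simp: card_gf(2)[OF char q e])
    have "card (D i) = (\<Prod>k\<le>m. card (if k = a then {0} else if k = b then {1} else gf q :: 'a set))"
      unfolding i D_def prod.case by (rule card_PiE) simp
    also have "\<dots> = (\<Prod>k\<in>{..m} - {a, b}. q)"
      by (rule prod.mono_neutral_cong_right) (use card_gf(1)[OF char q e] in auto)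
    also have "\<dots> = q ^ (m - 1)" using ab by (simp add: card_Diff_subset)
    finally show "card (D i) = q ^ (m - 1)" .
  qed
  have Z: "finite (Z c)" "card (Z c) \<le> m" if "i \<in> I" "c \<in> D i" for i c
  proof -
    obtain a b where i: "i = (a, b)" and ab: "a \<le> m" "b \<le> m" "a \<noteq> b"
      using \<open>i \<in> I\<close> by (auto simp: I_def)
    have "c \<in> (\<Pi>\<^sub>E k\<in>{..m}. if k = a then {0} else if k = b then {1} else gf q)"
      using that(2) by (simp add: i D_def)
    from PiE_mem[OF this, of b] have "c b = 1" using ab by simp
    define p where "p = (\<Sum>k\<le>m. monom (c k) k)"
    have "coeff p b = 1" using ab \<open>c b = 1\<close> by (simp add: p_def coeff_sum)
    then have "p \<noteq> 0" by auto
    moreover have "Z c = {x. poly p x = 0}" by (simp add: Z_def p_def poly_sum poly_monom)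
    moreover have "degree p \<le> m"
      unfolding p_def by (rule degree_sum_le) (auto intro: order_trans[OF degree_monom_le])
    ultimately show "finite (Z c)" "card (Z c) \<le> m"
      using card_poly_roots_le[of p] by auto
  qed
  have "x \<in> (\<Union>i\<in>I. \<Union>c\<in>D i. Z c)" if x: "x \<in> sparse_roots q m" for x :: 'a
  proof -
    obtain c a b where c: "\<forall>k\<le>m. c k \<in> gf q" "a \<le> m" "c a = 0" "b \<le> m" "c b \<noteq> 0"
        "(\<Sum>k\<le>m. c k * x ^ k) = 0"
      using x unfolding sparse_roots_def by blast
    define c' where "c' = restrict (\<lambda>k. c k * inverse (c b)) {..m}"
    have "(\<Sum>k\<le>m. c' k * x ^ k) = inverse (c b) * (\<Sum>k\<le>m. c k * x ^ k)"
      unfolding sum_distrib_left by (rule sum.cong) (auto simp: c'_def)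
    then have "x \<in> Z c'" using c(6) by (simp add: Z_def)
    moreover have "c' \<in> D (a, b)"
      unfolding D_def prod.case using c
      by (intro PiE_I) (auto simp: c'_def intro!: gf_mult[OF char q] gf_inverse[OF char q])
    moreover have "(a, b) \<in> I" using c by (auto simp: I_def)
    ultimately show ?thesis by blast
  qed
  then have sub: "sparse_roots q m \<subseteq> (\<Union>i\<in>I. \<Union>c\<in>D i. Z c)" by blast
  have fin: "finite (\<Union>i\<in>I. \<Union>c\<in>D i. Z c)" using I D Z by auto
  then show "finite (sparse_roots q m :: 'a set)" using sub finite_subset by blast
  have "card (\<Union>c\<in>D i. Z c) \<le> q ^ (m - 1) * m" if "i \<in> I" for i
  proof -
    have "card (\<Union>c\<in>D i. Z c) \<le> (\<Sum>c\<in>D i. card (Z c))" by (rule card_UN_le[OF D(2)[OF that]])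
    also have "\<dots> \<le> (\<Sum>c\<in>D i. m)" using Z(2)[OF that] by (rule sum_mono)
    finally show ?thesis using D(1)[OF that] by simp
  qed
  then have "(\<Sum>i\<in>I. card (\<Union>c\<in>D i. Z c)) \<le> (\<Sum>i\<in>I. q ^ (m - 1) * m)" by (rule sum_mono)
  moreover have "card (sparse_roots q m :: 'a set) \<le> card (\<Union>i\<in>I. \<Union>c\<in>D i. Z c)"
    by (rule card_mono[OF fin sub])
  moreover have "card (\<Union>i\<in>I. \<Union>c\<in>D i. Z c) \<le> (\<Sum>i\<in>I. card (\<Union>c\<in>D i. Z c))"
    by (rule card_UN_le[OF I(1)])
  moreover have "(\<Sum>i\<in>I. q ^ (m - 1) * m) \<le> (m + 1) ^ 2 * (q ^ (m - 1) * m)"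
    using I(2) by (simp add: mult_right_mono)
  ultimately show "card (sparse_roots q m :: 'a set) \<le> (m + 1) ^ 2 * (q ^ (m - 1) * m)" by linarith
qed


section \<open>The trace and its nondegeneracy\<close>

lemma gf_power_char: "prime CHAR('a::field) \<Longrightarrow> q = CHAR('a) ^ e \<Longrightarrow> q ^ m = CHAR('a) ^ (e * m)"
  by (simp add: power_mult)

text \<open>The q-th power map permutes the summands cyclically, since the last one is sent to
  x^(q^m) = x.\<close>

lemma trace_sum_in_gf:
  fixes x :: "'a::field"
  assumes char: "prime CHAR('a)" and q: "q = CHAR('a) ^ e" and x: "x \<in> gf (q ^ m)"
  shows "trace_sum q m x \<in> gf q"
proof -
  have "trace_sum q m x ^ q = (\<Sum>i<m. (x ^ (q ^ i)) ^ q)"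
    unfolding trace_sum_def by (rule freshmans_dream_sum'[OF char q])
  also have "\<dots> = (\<Sum>i<m. x ^ (q ^ Suc i))" by (simp add: mult.commute flip: power_mult)
  also have "\<dots> = (\<Sum>i<Suc m. x ^ (q ^ i)) - x" by (subst sum.lessThan_Suc_shift) simp
  also have "\<dots> = trace_sum q m x" using x by (simp add: trace_sum_def gf_def)
  finally show ?thesis by (simp add: gf_def)
qed

lemma trace_sum_diff:
  fixes x y :: "'a::field"
  assumes char: "prime CHAR('a)" and q: "q = CHAR('a) ^ e"
  shows "trace_sum q m (x - y) = trace_sum q m x - trace_sum q m y"
  unfolding trace_sum_def
  by (simp add: power_diff_char[OF char gf_power_char[OF char q]] sum_subtractf)

lemma trace_sum_lincomb:
  fixes f c :: "'b \<Rightarrow> 'a::field"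
  assumes char: "prime CHAR('a)" and q: "q = CHAR('a) ^ e"
    and c: "\<And>k. k \<in> I \<Longrightarrow> c k \<in> gf q"
  shows "trace_sum q m (\<Sum>k\<in>I. c k * f k) = (\<Sum>k\<in>I. c k * trace_sum q m (f k))"
proof -
  have "(\<Sum>k\<in>I. c k * f k) ^ (q ^ i) = (\<Sum>k\<in>I. c k * f k ^ (q ^ i))" for i
    unfolding freshmans_dream_sum'[OF char gf_power_char[OF char q]]
    using c gf_subset_gf_power[of q i] by (intro sum.cong) (auto simp: power_mult_distrib gf_def)
  then show ?thesis
    unfolding trace_sum_def sum_distrib_left by (subst sum.swap) simp
qed

text \<open>The trace is a nonzero polynomial of degree at most q^(m-1), too small to vanish on all
  q^m elements.\<close>

lemma trace_sum_nonzero: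
  fixes q :: nat
  assumes char: "prime CHAR('a::alg_closed_field)" and q: "q = CHAR('a) ^ e" "e > 0" and m: "m > 0"
  obtains x :: "'a::alg_closed_field" where "x \<in> gf (q ^ m)" "trace_sum q m x \<noteq> 0"
proof -
  define p :: "'a poly" where "p = (\<Sum>i<m. monom 1 (q ^ i))"
  have "q > 1" unfolding q by (rule one_less_power[OF prime_gt_1_nat[OF char] q(2)])
  have poly_p: "poly p x = trace_sum q m x" for x
    by (simp add: p_def trace_sum_def poly_sum poly_monom)
  \<comment> \<open>Since q > 1, only i = 0 contributes the monomial X, so \<open>p\<close> is not
    the zero polynomial.\<close>
  have "coeff p 1 = (\<Sum>i<m. if i = 0 then 1 else 0)"
    unfolding p_def coeff_sum coeff_monom using \<open>q > 1\<close>
    by (intro sum.cong) (auto simp: eq_commute[of _ 1])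
  then have "p \<noteq> 0" using m by auto
  have "degree p \<le> q ^ (m - 1)" unfolding p_def
    by (rule degree_sum_le)
      (use \<open>q > 1\<close> in \<open>auto intro!: order_trans[OF degree_monom_le] power_increasing\<close>)
  also have "\<dots> < q ^ m" using \<open>q > 1\<close> m by (intro power_strict_increasing) auto
  also have "\<dots> = card (gf (q ^ m) :: 'a set)"
    using card_gf(1)[OF char gf_power_char[OF char q(1)]] q(2) m by simp
  finally have "card {x. poly p x = 0} < card (gf (q ^ m) :: 'a set)"
    using card_poly_roots_le(2)[OF \<open>p \<noteq> 0\<close>] by linarith
  then have "\<not> gf (q ^ m) \<subseteq> {x. poly p x = 0}"
    using card_mono[OF card_poly_roots_le(1)[OF \<open>p \<noteq> 0\<close>], of "gf (q ^ m)"] by linarith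
  then show ?thesis using that poly_p by auto
qed

text \<open>The \<open>m\<close> powers of \<alpha> other than the r-th form a basis of
  \<open>gf (q ^ m)\<close> over \<open>gf q\<close>. If \<gamma> were nonzero, its multiples would
  fill the field, and the trace would vanish identically by linearity.\<close>

lemma trace_sum_vanishing:
  fixes \<alpha> \<gamma> :: "'a::alg_closed_field"
  assumes char: "prime CHAR('a)" and q: "q = CHAR('a) ^ e" "e > 0" and m: "m > 0"
    and \<alpha>: "\<alpha> \<in> gf (q ^ m)" "\<alpha> \<notin> sparse_roots q m" and \<gamma>: "\<gamma> \<in> gf (q ^ m)" and r: "r \<le> m"
    and zero: "\<And>k. k \<le> m \<Longrightarrow> k \<noteq> r \<Longrightarrow> trace_sum q m (\<gamma> * \<alpha> ^ k) = 0"
  shows "\<gamma> = 0"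
proof (rule ccontr)
  assume "\<gamma> \<noteq> 0"
  let ?K = "gf (q ^ m) :: 'a set"
  let ?I = "{..m} - {r}"
  define comb where "comb = (\<lambda>c. \<Sum>k\<in>?I. c k * \<alpha> ^ k)"
  note Q = gf_power_char[OF char q(1), of m]
  have card_K: "card ?K = q ^ m" and fin_K: "finite ?K"
    using card_gf[OF char Q] q(2) m by simp_all
  \<comment> \<open>Spanning is obtained by counting: independence makes \<open>comb\<close>
    injective, and there are q^m coefficient vectors for q^m field elements.\<close>
  have inj: "inj_on comb (?I \<rightarrow>\<^sub>E gf q)"
  proof (rule inj_onI)
    fix c c' assume c: "c \<in> ?I \<rightarrow>\<^sub>E gf q" "c' \<in> ?I \<rightarrow>\<^sub>E gf q" and eq: "comb c = comb c'"
    define b where "b = (\<lambda>k. if k = r then 0 else c k - c' k)"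
    have "(\<Sum>k\<le>m. b k * \<alpha> ^ k) = (\<Sum>k\<in>?I. (c k - c' k) * \<alpha> ^ k)"
      by (rule sum.mono_neutral_cong_right) (auto simp: b_def)
    also have "\<dots> = 0" using eq by (simp add: comb_def left_diff_distrib sum_subtractf)
    finally have "(\<Sum>k\<le>m. b k * \<alpha> ^ k) = 0" .
    moreover have "b k \<in> gf q" if "k \<le> m" for k
      using c that by (auto simp: b_def gf_0[OF char q(1)] intro!: gf_diff[OF char q(1)])
    moreover have "b r = 0" by (simp add: b_def)
    ultimately have b_0: "b k = 0" if "k \<le> m" for k
      using \<alpha>(2) r that unfolding sparse_roots_def by blast
    have "c k = c' k" if "k \<in> ?I" for k using b_0[of k] that by (simp add: b_def)
    then show "c = c'" using c by (intro PiE_ext[of c ?I _ c']) auto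
  qed
  have "comb ` (?I \<rightarrow>\<^sub>E gf q) \<subseteq> ?K"
  proof
    fix y assume "y \<in> comb ` (?I \<rightarrow>\<^sub>E gf q)"
    then obtain c where c: "c \<in> ?I \<rightarrow>\<^sub>E gf q" and y: "y = comb c" by blast
    have "c k * \<alpha> ^ k \<in> ?K" if "k \<in> ?I" for k
      using PiE_mem[OF c that] gf_subset_gf_power[of q m] gf_mult[OF char Q] gf_power[OF char Q \<alpha>(1)]
      by blast
    then show "y \<in> ?K" unfolding y comb_def by (rule gf_sum[OF char Q])
  qed
  moreover have "card (comb ` (?I \<rightarrow>\<^sub>E gf q)) = card ?K"
  proof -
    have "card (comb ` (?I \<rightarrow>\<^sub>E gf q)) = card (gf q :: 'a set) ^ card ?I"
      using card_image[OF inj] by (simp add: card_PiE)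
    then show ?thesis using card_gf(1)[OF char q] r by (simp add: card_K)
  qed
  ultimately have surj: "comb ` (?I \<rightarrow>\<^sub>E gf q) = ?K" using card_subset_eq[OF fin_K] by blast
  obtain x where x: "x \<in> ?K" "trace_sum q m x \<noteq> 0"
    using trace_sum_nonzero[OF char q m] by blast
  have "x * inverse \<gamma> \<in> ?K" by (intro gf_mult[OF char Q] gf_inverse[OF char Q] x \<gamma>)
  then obtain c where c: "c \<in> ?I \<rightarrow>\<^sub>E gf q" "x * inverse \<gamma> = comb c" using surj by blast
  have "x = \<gamma> * comb c" using c(2)[symmetric] \<open>\<gamma> \<noteq> 0\<close> by simp
  also have "\<dots> = (\<Sum>k\<in>?I. c k * (\<gamma> * \<alpha> ^ k))"
    unfolding comb_def sum_distrib_left by (simp add: mult_ac)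
  finally have "trace_sum q m x = (\<Sum>k\<in>?I. c k * trace_sum q m (\<gamma> * \<alpha> ^ k))"
    using trace_sum_lincomb[OF char q(1), of ?I c m "\<lambda>k. \<gamma> * \<alpha> ^ k"] PiE_mem[OF c(1)] by simp
  also have "\<dots> = 0" using zero by (intro sum.neutral) auto
  finally show False using x(2) by simp
qed

text \<open>Agreement outside place \<open>r\<close> says that the traces of (\<alpha>^i -
  \<alpha>^j) \<alpha>^l vanish for l \<noteq> r. Hence \<alpha>^i = \<alpha>^j, and primitivity of
  \<alpha> gives i = j. The condition \<open>big\<close> makes primitive elements outnumber
  \<open>sparse_roots\<close>.\<close>

lemma exists_window_separated_sequence:
  fixes m k :: nat
  assumes m: "m \<ge> 1" and k: "k \<ge> 1" and big: "2 * ((m + 1) ^ 2 * m * (k * m)) < 2 ^ k"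
  defines "q \<equiv> 2 ^ k"
  obtains s :: "nat \<Rightarrow> nat" where "\<And>t. s t < q"
    and "\<And>i j r. i < q ^ m - 1 \<Longrightarrow> j < q ^ m - 1 \<Longrightarrow> r \<le> m \<Longrightarrow>
      (\<And>l. l \<le> m \<Longrightarrow> l \<noteq> r \<Longrightarrow> s (i + l) = s (j + l)) \<Longrightarrow> i = j"
proof -
  have CHAR_bit: "CHAR(bit) = 2"
    by (rule CHAR_eq_posI) (auto simp: numeral_2_eq_2 less_Suc_eq)
  then have char: "prime CHAR(bit alg_closure)" by simp
  have q: "q = CHAR(bit alg_closure) ^ k" "k > 0" using k by (simp_all add: q_def CHAR_bit)
  note Q = gf_power_char[OF char q(1), of m]
  have e: "k * m > 0" using k m by simp
  let ?K = "gf (q ^ m) :: bit alg_closure set"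
  let ?N = "q ^ m - 1"
  let ?P = "{x \<in> ?K. inj_on (\<lambda>i::nat. x ^ i) {..<?N}}"
  let ?S = "sparse_roots q m :: bit alg_closure set"
  have "q \<ge> 2" using q(2) self_le_power[of 2 k] by (simp add: q_def)
  then have "2 \<le> q ^ m" using m self_le_power[of q m] by linarith
  have half: "q ^ m \<le> 2 * ?N" and pos: "0 < ?N" using \<open>2 \<le> q ^ m\<close> by linarith+
  have "?N < 2 ^ (k * m)" using \<open>2 \<le> q ^ m\<close> by (simp add: q_def power_mult)
  then have tot: "?N \<le> k * m * totient ?N" by (rule le_totient_mult_log[OF pos])
  \<comment> \<open>Both cardinalities are compared after multiplication by 2 k m, which avoids
    division; the factor 2 pays for replacing q^m - 1 by q^m.\<close>
  have "card ?S * (2 * (k * m)) \<le> (m + 1) ^ 2 * (q ^ (m - 1) * m) * (2 * (k * m))"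
    by (rule mult_right_mono[OF card_sparse_roots(2)[OF char q]]) simp
  also have "\<dots> = q ^ (m - 1) * (2 * ((m + 1) ^ 2 * m * (k * m)))" by (simp only: mult_ac)
  also have "\<dots> < q ^ (m - 1) * q" using big \<open>q \<ge> 2\<close> unfolding q_def by (intro mult_strict_left_mono) auto
  also have "\<dots> = q ^ m" using m by (metis Suc_diff_1 less_le_trans power_Suc2 zero_less_one)
  also have "\<dots> \<le> 2 * (k * m * totient ?N)" using half tot by linarith
  also have "\<dots> = totient ?N * (2 * (k * m))" by (simp only: mult_ac)
  finally have "card ?S < totient ?N" by simp
  also have "\<dots> \<le> card ?P" by (rule totient_le_card_primitive[OF char Q e])
  finally have "card ?S < card ?P" .
  then have "\<not> ?P \<subseteq> ?S" using card_mono[OF card_sparse_roots(1)[OF char q]] by (meson not_less)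
  then obtain \<alpha> where \<alpha>: "\<alpha> \<in> ?K" "\<alpha> \<notin> ?S" and inj: "inj_on (\<lambda>i::nat. \<alpha> ^ i) {..<?N}" by blast
  define u where "u = (\<lambda>t. trace_sum q m (\<alpha> ^ t))"
  have u: "u t \<in> gf q" for t
    unfolding u_def by (intro trace_sum_in_gf[OF char q(1)] gf_power[OF char Q] \<alpha>)
  \<comment> \<open>Renaming field elements as numbers below \<open>q\<close> is injective, so it
    neither creates nor destroys agreements.\<close>
  obtain b where b: "bij_betw b (gf q :: bit alg_closure set) {0..<q}"
    using ex_bij_betw_finite_nat[OF card_gf(2)[OF char q]] card_gf(1)[OF char q] by auto
  show ?thesis
  proof
    show "b (u t) < q" for t using bij_betwE[OF b] u by auto
    fix i j r assume ij: "i < ?N" "j < ?N" and r: "r \<le> m"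
      and eq: "\<And>l. l \<le> m \<Longrightarrow> l \<noteq> r \<Longrightarrow> b (u (i + l)) = b (u (j + l))"
    have "trace_sum q m ((\<alpha> ^ i - \<alpha> ^ j) * \<alpha> ^ l) = 0" if "l \<le> m" "l \<noteq> r" for l
    proof -
      have "u (i + l) = u (j + l)"
        using inj_onD[OF bij_betw_imp_inj_on[OF b] eq[OF that]] u by blast
      then show ?thesis
        by (simp add: u_def left_diff_distrib power_add trace_sum_diff[OF char q(1)])
    qed
    moreover have "\<alpha> ^ i - \<alpha> ^ j \<in> ?K"
      by (intro gf_diff[OF char Q] gf_power[OF char Q] \<alpha>)
    ultimately have "\<alpha> ^ i - \<alpha> ^ j = 0"
      using trace_sum_vanishing[OF char q _ \<alpha>, of "\<alpha> ^ i - \<alpha> ^ j" r] m r by simp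
    then show "i = j" using inj_onD[OF inj, of i j] ij by simp
  qed
qed

lemma infinite_good_exponents:
  fixes C :: nat
  shows "infinite {k::nat. k \<ge> 1 \<and> C * k < 2 ^ k}"
proof -
  have "eventually (\<lambda>k::nat. real (Suc C) * real k < 2 ^ k) at_top" by real_asymp
  then have "eventually (\<lambda>k. k \<ge> 1 \<and> C * k < 2 ^ k) at_top"
    using eventually_ge_at_top[of 1]
  proof eventually_elim
    case (elim k)
    have "real (C * k) \<le> real (Suc C) * real k" by (simp add: algebra_simps)
    also have "\<dots> < real (2 ^ k)" using elim by simp
    finally show ?case using elim by linarith
  qed
  then show ?thesis
    by (metis eventually_sequentially infinite_nat_iff_unbounded_le mem_Collect_eq nle_le)
qed

section \<open>Complexes of windows\<close>

lemma H_s_ge: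
  assumes "finite V" "card V = n" "pure_complex d (V::nat set) C" "strongly_connected_complex d C"
  shows "complex_diameter d C \<le> H_s n d"
  unfolding H_s_def
  by (rule Max_ge[OF diameters_finite]) (use assms in \<open>auto simp: diameters_def\<close>)

lemma H_s_nonneg:
  assumes "d \<le> n"
  shows "0 \<le> H_s n d"
proof -
  obtain x where "x \<in> diameters n d" using diameters_nonempty[OF assms] by blast
  then obtain V :: "nat set" and C where *: "finite V" "card V = n" "pure_complex d V C"
      "strongly_connected_complex d C"
    by (auto simp: diameters_def)
  obtain k where "complex_diameter d C = ereal (real k)"
    using complex_diameter_nat[OF *(3,1,4)] by blast
  then show ?thesis using H_s_ge[OF *] by (metis ereal_less_eq(3) of_nat_0_le_iff order_trans zero_ereal_def)
qed

text \<open>The dual graph is an induced path, so every arc raises the index by at most one and a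
  walk from \<open>F 0\<close> to \<open>F L\<close> has at least \<open>L\<close> arcs.\<close>

lemma induced_path_complex:
  fixes F :: "nat \<Rightarrow> 'a set"
  assumes fin: "finite V" and pure: "pure_complex d V (F ` {..L})"
    and step: "\<And>i. i < L \<Longrightarrow> card (F i \<inter> F (Suc i)) + 1 = d"
    and adj: "\<And>i j. i < j \<Longrightarrow> j \<le> L \<Longrightarrow> card (F i \<inter> F j) + 1 = d \<Longrightarrow> j = Suc i"
    and inj: "inj_on F {..L}"
  shows "strongly_connected_complex d (F ` {..L})"
    and "ereal (real L) \<le> complex_diameter d (F ` {..L})"
proof -
  let ?C = "F ` {..L}"
  let ?G = "with_proj (dual_graph d ?C)"
  interpret pair_graph "dual_graph d ?C" by (rule dual_graph_pair_graph[OF pure fin])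
  have arc: "(F i, F (Suc i)) \<in> parcs (dual_graph d ?C)" "(F (Suc i), F i) \<in> parcs (dual_graph d ?C)"
    if "i < L" for i
    using that step[OF that] by (auto simp: Int_commute)
  have fwd: "F 0 \<rightarrow>\<^sup>*\<^bsub>?G\<^esub> F i \<and> F i \<rightarrow>\<^sup>*\<^bsub>?G\<^esub> F 0" if "i \<le> L" for i
    using that
  proof (induction i)
    case 0
    then show ?case by (auto intro!: reachable_refl)
  next
    case (Suc i)
    then have IH: "F 0 \<rightarrow>\<^sup>*\<^bsub>?G\<^esub> F i" "F i \<rightarrow>\<^sup>*\<^bsub>?G\<^esub> F 0" and "i < L" by auto
    show ?case
      using reachable_adj_trans[OF IH(1) arc(1)[OF \<open>i < L\<close>]]
        adj_reachable_trans[OF arc(2)[OF \<open>i < L\<close>] IH(2)] by blast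
  qed
  show "strongly_connected_complex d ?C"
    unfolding strongly_connected_complex_iff[OF pure fin]
    using fwd reachable_trans by blast
  have walk: "L \<le> i + length p" if "cas (F i) p (F L)" "set p \<subseteq> arcs ?G" "i \<le> L" for p i
    using that
  proof (induction p arbitrary: i)
    case Nil
    then show ?case using inj_onD[OF inj] by simp
  next
    case (Cons e p)
    from Cons.prems(1,2) have e: "fst e = F i" "e \<in> parcs (dual_graph d ?C)" by auto
    then obtain j where j: "snd e = F j" "j \<le> L" "card (F i \<inter> F j) + 1 = d" by auto
    have "j \<le> Suc i" using adj[of i j] j by (cases "i < j") auto
    moreover have "L \<le> j + length p" using Cons.IH[of j] Cons.prems j by auto
    ultimately show ?case by simp
  qed
  have "ereal (real L) \<le> wf_digraph.\<mu> ?G (\<lambda>_. 1) (F 0) (F L)"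
    unfolding \<mu>_def
    using walk[of 0] by (auto intro!: INF_greatest simp: awalk_def awalk_cost_def sum_list_triv)
  also have "\<dots> \<le> (SUP v\<in>?C. wf_digraph.\<mu> ?G (\<lambda>_. 1) (F 0) v)" by (rule SUP_upper) auto
  also have "\<dots> \<le> (SUP u\<in>?C. SUP v\<in>?C. wf_digraph.\<mu> ?G (\<lambda>_. 1) u v)"
    by (rule SUP_upper[where f = "\<lambda>u. SUP v\<in>?C. wf_digraph.\<mu> ?G (\<lambda>_. 1) u v"]) auto
  finally show "ereal (real L) \<le> complex_diameter d ?C"
    by (simp add: complex_diameter_def graph_diameter_def)
qed

text \<open>The vertex with symbol \<open>s t\<close> and colour \<open>t mod (m + 3)\<close> is encoded as a single number.\<close>

definition window :: "nat \<Rightarrow> (nat \<Rightarrow> nat) \<Rightarrow> nat \<Rightarrow> nat set" where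
  "window m s i = (\<lambda>t. s t * (m + 3) + t mod (m + 3)) ` {i..i + m}"

context
  fixes m :: nat and s :: "nat \<Rightarrow> nat" and v :: "nat \<Rightarrow> nat"
  assumes m: "m \<ge> 1"
  defines "v \<equiv> \<lambda>t. s t * (m + 3) + t mod (m + 3)"
begin

lemma vertex_eq_iff: "v i = v j \<longleftrightarrow> s i = s j \<and> i mod (m + 3) = j mod (m + 3)"
proof
  assume eq: "v i = v j"
  have "v t mod (m + 3) = t mod (m + 3)" "v t div (m + 3) = s t" for t
    by (simp_all add: v_def)
  with eq show "s i = s j \<and> i mod (m + 3) = j mod (m + 3)" by metis
qed (simp add: v_def)

lemma window_altdef: "window m s i = v ` {i..i + m}"
  by (simp add: window_def v_def)

lemma mod_eq_imp_eq:
  assumes "t mod (m + 3) = t' mod (m + 3)" "t \<le> t'" "t' < t + m + 3"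
  shows "t = t'"
proof -
  have "m + 3 dvd t' - t" using assms(1,2) mod_eq_dvd_iff_nat[of t t' "m + 3"] by simp
  moreover have "t' - t < m + 3" using assms(2,3) by linarith
  ultimately have "t' - t = 0" using nat_dvd_not_less by blast
  then show ?thesis using assms(2) by simp
qed

lemma inj_on_vertex: "inj_on v {i..i + m + 2}"
proof (rule inj_onI)
  fix x y assume "x \<in> {i..i + m + 2}" "y \<in> {i..i + m + 2}" "v x = v y"
  then show "x = y" using mod_eq_imp_eq[of x y] mod_eq_imp_eq[of y x]
    by (cases "x \<le> y") (auto simp: vertex_eq_iff)
qed

lemma card_window: "card (window m s i) = m + 1" "finite (window m s i)"
  using inj_on_subset[OF inj_on_vertex[of i], of "{i..i + m}"]
  by (auto simp: window_altdef card_image)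

lemma card_window_Int_Suc: "card (window m s i \<inter> window m s (Suc i)) = m"
proof -
  have "window m s i \<inter> window m s (Suc i) = v ` ({i..i + m} \<inter> {Suc i..Suc i + m})"
    unfolding window_altdef
    by (rule inj_on_image_Int[OF inj_on_vertex[of i], symmetric]) auto
  also have "{i..i + m} \<inter> {Suc i..Suc i + m} = {Suc i..i + m}" by auto
  finally show ?thesis
    using inj_on_subset[OF inj_on_vertex[of i], of "{Suc i..i + m}"] by (simp add: card_image)
qed

text \<open>The window at \<open>j\<close> misses the colours of \<open>j - 1\<close> and \<open>j - 2\<close>. Unless \<open>i\<close> is congruent to \<open>j\<close>,
  \<open>j - 1\<close> or \<open>j + 1\<close>, both colours occur in the window at \<open>i\<close>, so that two of its vertices are lost.\<close>

lemma window_near_cases: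
  assumes "i < j" and near: "card (window m s i \<inter> window m s j) \<ge> m"
  shows "(\<exists>r\<le>m. \<forall>k\<le>m. k \<noteq> r \<longrightarrow> s (i + k) = s (j + k)) \<or>
         (\<forall>k<m. s (Suc i + k) = s (j + k)) \<or> (\<forall>k<m. s (i + k) = s (Suc j + k))"
proof -
  \<comment> \<open>The colour offset of the window at \<open>j\<close> from the window at
    \<open>i\<close>. Below, \<open>B\<close> collects the places of the window at \<open>i\<close>
    whose vertex is lost; there is at most one.\<close>
  define \<delta> where "\<delta> = (j - i) mod (m + 3)"
  have \<delta>: "(i + \<delta>) mod (m + 3) = j mod (m + 3)" "\<delta> < m + 3"
    using \<open>i < j\<close> by (simp_all add: \<delta>_def mod_simps)
  define B where "B = {k\<in>{..m}. v (i + k) \<notin> window m s j}"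
  have inj: "inj_on (\<lambda>k. v (i + k)) {..m}"
    using inj_on_subset[OF inj_on_vertex[of i], of "{i..i + m}"]
    by (intro inj_onI) (auto dest: inj_onD)
  have "(\<lambda>k. v (i + k)) ` ({..m} - B) = window m s i \<inter> window m s j"
  proof -
    have "{i..i + m} = (\<lambda>k. i + k) ` {..m}" 
      using image_add_atLeastAtMost[of i 0 m] by (simp add: atLeast0AtMost add.commute)
    then show ?thesis by (auto simp: B_def window_altdef[of i])
  qed
  then have "card ({..m} - B) = card (window m s i \<inter> window m s j)"
    using inj_on_subset[OF inj, of "{..m} - B"] card_image by (metis Diff_subset)
  moreover have "card ({..m} - B) = m + 1 - card B"
    by (subst card_Diff_subset) (auto simp: B_def)
  ultimately have B1: "card B \<le> 1" using near m by simp
  have B: "k = k'" if "k \<in> B" "k' \<in> B" for k k'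
    using B1 that by (metis One_nat_def card_le_Suc0_iff_eq B_def finite_Collect_conjI finite_atMost
        Collect_mem_eq)
  have col: "\<exists>k'\<le>m. (i + k) mod (m + 3) = (j + k') mod (m + 3) \<and> s (i + k) = s (j + k')"
    if "k \<le> m" "k \<notin> B" for k
  proof -
    from that have "v (i + k) \<in> window m s j" by (simp add: B_def)
    then obtain t where "t \<in> {j..j + m}" "v (i + k) = v t" by (auto simp: window_altdef)
    then show ?thesis by (intro exI[of _ "t - j"]) (auto simp: vertex_eq_iff)
  qed
  \<comment> \<open>The cases e = 1 and e = 2 are the colours of j - 1 and j - 2, expressed by
    addition to avoid truncated subtraction.\<close>
  have colB: "k \<in> B" 
    if h: "k \<le> m" "(i + k + e) mod (m + 3) = j mod (m + 3)" "e = 1 \<or> e = 2" for k e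
  proof (rule ccontr)
    assume "k \<notin> B"
    with \<open>k \<le> m\<close> obtain k' where k': "k' \<le> m" "(i + k) mod (m + 3) = (j + k') mod (m + 3)"
      using col[of k] by auto
    then have "(j + k' + e) mod (m + 3) = j mod (m + 3)" using h(2) by (metis mod_add_left_eq)
    then show False using mod_eq_imp_eq[of j "j + k' + e"] k' h(3) by auto
  qed
  have match: "s (i + k) = s (j + k')" 
    if h: "k \<le> m" "k \<notin> B" "(i + k) mod (m + 3) = (j + k') mod (m + 3)" "k' \<le> m" for k k'
  proof -
    obtain l where l: "l \<le> m" "(i + k) mod (m + 3) = (j + l) mod (m + 3)" "s (i + k) = s (j + l)"
      using col[of k] h by auto
    have "l = k'" using mod_eq_imp_eq[of "j + l" "j + k'"] mod_eq_imp_eq[of "j + k'" "j + l"] l h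
      by (cases "l \<le> k'") auto
    with l show ?thesis by simp
  qed
  \<comment> \<open>The offset \<open>m + 2\<close> is -1 modulo \<open>m + 3\<close>. In the last
    case the places \<delta> - 1 and \<delta> - 2 are both lost. For offsets 1 and -1, the lost
    place is 0 or \<open>m\<close>, so all others match.\<close>
  consider "\<delta> = 0" | "\<delta> = 1" | "\<delta> = m + 2" | "2 \<le> \<delta>" "\<delta> \<le> m + 1" using \<delta>(2) by linarith
  then show ?thesis
  proof cases
    case 1
    obtain r where r: "r \<le> m" "\<And>k. k \<in> B \<Longrightarrow> k = r"
    proof (cases "B = {}")
      case False
      then obtain r where "r \<in> B" by blast
      moreover from this have "r \<le> m" by (simp add: B_def)
      ultimately show ?thesis using that[of r] B[of _ r] by blast
    qed (use that[of 0] in auto)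
    have "s (i + k) = s (j + k)" if "k \<le> m" "k \<noteq> r" for k
      using match[of k k] that r(2) \<delta>(1) 1 by (metis add_0_right mod_add_left_eq)
    with r show ?thesis by blast
  next
    case 2
    have 0: "0 \<in> B" using colB[of 0 1] \<delta>(1) 2 by simp
    have "s (Suc i + k) = s (j + k)" if "k < m" for k
    proof -
      have "(i + 1 + k) mod (m + 3) = (j + k) mod (m + 3)" using \<delta>(1) 2 by (metis mod_add_left_eq)
      moreover have "Suc k \<notin> B" using B[OF 0] by blast
      ultimately show ?thesis using match[of "Suc k" k] that by simp
    qed
    then show ?thesis by blast
  next
    case 3
    have shift: "i mod (m + 3) = Suc j mod (m + 3)"
    proof -
      have "Suc j mod (m + 3) = (i + \<delta> + 1) mod (m + 3)" using \<delta>(1) by (metis Suc_eq_plus1 mod_add_left_eq)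
      also have "i + \<delta> + 1 = i + (m + 3)" using 3 by simp
      finally show ?thesis by simp
    qed
    then have "(i + m + 2) mod (m + 3) = (Suc j + m + 2) mod (m + 3)" by (metis mod_add_left_eq add.assoc)
    also have "Suc j + m + 2 = j + (m + 3)" by simp
    finally have "m \<in> B" using colB[of m 2] by simp
    have "s (i + k) = s (Suc j + k)" if "k < m" for k
    proof -
      have "(i + k) mod (m + 3) = (j + Suc k) mod (m + 3)" using shift by (metis mod_add_left_eq add_Suc_shift)
      moreover have "k \<notin> B" using B[OF \<open>m \<in> B\<close>] that by blast
      ultimately show ?thesis using match[of k "Suc k"] that by simp
    qed
    then show ?thesis by blast
  next
    case 4
    have "\<delta> - 1 \<in> B" using colB[of "\<delta> - 1" 1] 4 \<delta>(1) by simp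
    moreover have "i + (\<delta> - 2) + 2 = i + \<delta>" using 4 by simp
    then have "\<delta> - 2 \<in> B" using colB[of "\<delta> - 2" 2] 4 \<delta>(1) by simp
    ultimately show ?thesis using B[of "\<delta> - 1" "\<delta> - 2"] 4 by simp
  qed
qed

end

text \<open>Separation excludes every near pair of windows except consecutive ones. The shifted
  cases compare windows up to position \<open>Suc L\<close>, whence the bound on
  \<open>L\<close>.\<close>

lemma H_s_window_bound:
  fixes s :: "nat \<Rightarrow> nat"
  assumes m: "m \<ge> 1" and L: "Suc L < N" and range: "\<And>t. s t < q"
    and sep: "\<And>i j r. i < N \<Longrightarrow> j < N \<Longrightarrow> r \<le> m \<Longrightarrow>
      (\<And>k. k \<le> m \<Longrightarrow> k \<noteq> r \<Longrightarrow> s (i + k) = s (j + k)) \<Longrightarrow> i = j"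
  shows "ereal (real L) \<le> H_s ((m + 3) * q) (m + 1)"
proof -
  let ?F = "window m s"
  let ?V = "{..<(m + 3) * q}"
  have "window m s i \<subseteq> ?V" for i
  proof -
    have "s t * (m + 3) + t mod (m + 3) < (m + 3) * q" for t
    proof -
      have "s t * (m + 3) + t mod (m + 3) < Suc (s t) * (m + 3)" by simp
      also have "\<dots> \<le> q * (m + 3)" using range[of t] by (intro mult_right_mono) auto
      finally show ?thesis by (simp add: mult.commute)
    qed
    then show ?thesis by (auto simp: window_def)
  qed
  then have pure: "pure_complex (m + 1) ?V (?F ` {..L})"
    using card_window[OF m] by (auto simp: pure_complex_def)
  have near: "j = Suc i" if ij: "i < j" "j \<le> L" and "card (?F i \<inter> ?F j) \<ge> m" for i j
    using window_near_cases[OF m ij(1) that(3)]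
  proof (elim disjE exE conjE)
    fix r assume "r \<le> m" "\<forall>k\<le>m. k \<noteq> r \<longrightarrow> s (i + k) = s (j + k)"
    then show ?thesis using sep[of i j r] ij L by auto
  next
    \<comment> \<open>A shift leaves only the first \<open>m\<close> places to compare, so the
      exempt place is r = m. Here separation yields \<open>Suc i = j\<close>; in the other shift it
      yields the impossible \<open>i = Suc j\<close>.\<close>
    assume "\<forall>k<m. s (Suc i + k) = s (j + k)"
    then show ?thesis using sep[of "Suc i" j m] ij L by auto
  next
    assume "\<forall>k<m. s (i + k) = s (Suc j + k)"
    then show ?thesis using sep[of i "Suc j" m] ij L by auto
  qed
  \<comment> \<open>Equal windows would be near, hence consecutive, but consecutive windows share
    only \<open>m\<close> of their \<open>m + 1\<close> vertices.\<close>
  have inj: "inj_on ?F {..L}"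
  proof (rule linorder_inj_onI)
    fix i j assume ij: "i < j" "i \<in> {..L}" "j \<in> {..L}"
    show "?F i \<noteq> ?F j"
    proof
      assume eq: "?F i = ?F j"
      then have "j = Suc i" using near[of i j] ij card_window[OF m, of s j] by auto
      then show False using eq card_window_Int_Suc[OF m, of s i] card_window[OF m, of s j] by auto
    qed
  qed auto
  have adj: "j = Suc i" if "i < j" "j \<le> L" "card (?F i \<inter> ?F j) + 1 = m + 1" for i j
    using near[of i j] that by simp
  note path = induced_path_complex[OF _ pure _ adj inj, simplified card_window_Int_Suc[OF m], simplified]
  show ?thesis
    using path H_s_ge[of ?V "(m + 3) * q" "m + 1" "?F ` {..L}"] pure
    by (simp add: order_trans)
qed

section \<open>Choice of n, and the degenerate cases d \<le> 1\<close>

theorem theorem1p2: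
  fixes d :: nat
  shows "infinite {n :: nat.
    H_s n d \<ge> ereal (real n powi (int d - 1) / real (d + 2) powi (int d - 1) - 3)}"
proof (cases "d \<le> 1")
  case True
  have "{1..} \<subseteq> {n. H_s n d \<ge> ereal (real n powi (int d - 1) / real (d + 2) powi (int d - 1) - 3)}"
  proof
    fix n :: nat assume "n \<in> {1..}"
    then have n: "n \<ge> 1" by simp
    \<comment> \<open>The left side is 2 / n - 3 for d = 0 and -2 for d = 1.\<close>
    have "real n powi (int d - 1) / real (d + 2) powi (int d - 1) - 3 \<le> 0"
    proof (cases "d = 0")
      case True
      then show ?thesis using n by (simp add: power_int_minus field_simps)
    next
      case False
      then have "d = 1" using \<open>d \<le> 1\<close> by simp
      then show ?thesis by simp
    qed
    then have "ereal (real n powi (int d - 1) / real (d + 2) powi (int d - 1) - 3) \<le> 0"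
      by (simp only: zero_ereal_def ereal_less_eq)
    also have "0 \<le> H_s n d" using n True by (intro H_s_nonneg) simp
    finally show "n \<in> {n. H_s n d \<ge> ereal (real n powi (int d - 1) / real (d + 2) powi (int d - 1) - 3)}"
      by simp
  qed
  then show ?thesis using infinite_Ici finite_subset by blast
next
  case False
  define m where "m = d - 1"
  have m: "m \<ge> 1" "d = m + 1" using False by (simp_all add: m_def)
  define K where "K = {k::nat. k \<ge> 1 \<and> (2 * ((m + 1) ^ 2 * m * m)) * k < 2 ^ k}"
  have "inj_on (\<lambda>k. (m + 3) * 2 ^ k) K" by (auto intro!: inj_onI)
  then have "infinite ((\<lambda>k. (m + 3) * 2 ^ k) ` K)"
    using infinite_good_exponents[of "2 * ((m + 1) ^ 2 * m * m)"] finite_imageD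
    unfolding K_def by blast
  moreover have "(\<lambda>k. (m + 3) * 2 ^ k) ` K \<subseteq>
      {n. H_s n d \<ge> ereal (real n powi (int d - 1) / real (d + 2) powi (int d - 1) - 3)}"
  proof (intro image_subsetI CollectI)
    fix k assume "k \<in> K"
    then have k: "k \<ge> 1" and big: "2 * ((m + 1) ^ 2 * m * (k * m)) < 2 ^ k"
      by (simp_all add: K_def mult_ac)
    define q :: nat where "q = 2 ^ k"
    obtain s where s: "\<And>t. s t < q"
      "\<And>i j r. i < q ^ m - 1 \<Longrightarrow> j < q ^ m - 1 \<Longrightarrow> r \<le> m \<Longrightarrow>
        (\<And>l. l \<le> m \<Longrightarrow> l \<noteq> r \<Longrightarrow> s (i + l) = s (j + l)) \<Longrightarrow> i = j"
      using exists_window_separated_sequence[OF m(1) k big] unfolding q_def by blast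
    have "1 \<le> (m + 1) ^ 2 * m * (k * m)" using m k by simp
    then have "3 \<le> q" using big unfolding q_def by linarith
    also have "q \<le> q ^ m" using m \<open>3 \<le> q\<close> by (intro self_le_power) auto
    finally have "3 \<le> q ^ m" .
    \<comment> \<open>The length q^m - 3 is the largest that the window bound admits for N = q^m -
      1, which is the source of the -3. As n / (d + 2) = q, it equals the claimed bound.\<close>
    then have "Suc (q ^ m - 3) < q ^ m - 1" by simp
    from H_s_window_bound[OF m(1) this s]
    have "ereal (real (q ^ m - 3)) \<le> H_s ((m + 3) * q) (m + 1)" .
    moreover have "real ((m + 3) * q) powi (int d - 1) / real (d + 2) powi (int d - 1) - 3 = real (q ^ m - 3)"
    proof -
      have "int d - 1 = int m" "d + 2 = m + 3" using m by simp_all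
      then have "real ((m + 3) * q) powi (int d - 1) / real (d + 2) powi (int d - 1) = real q ^ m"
        by (simp only: power_int_of_nat of_nat_mult power_mult_distrib) simp
      then show ?thesis using \<open>3 \<le> q ^ m\<close> by (simp add: of_nat_diff)
    qed
    ultimately show "H_s ((m + 3) * 2 ^ k) d \<ge>
        ereal (real ((m + 3) * 2 ^ k) powi (int d - 1) / real (d + 2) powi (int d - 1) - 3)"
      using m by (simp only: q_def)
  qed
  ultimately show ?thesis using infinite_super by blast
qed

end
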